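(* Let $I\subset[0,\infty)$ be an interval, $f:I\to\mathbb{R}$ differentiable on the interior $I^{\circ}$, $m\in(0,1]$, and $a,b\in I^{\circ}$ with $a<b$ and $ma,mb\in I^{\circ}$, such that $f'\in L[ma,mb]$. Suppose $|f'|^{q}$ is $m$-convex on $[ma,mb]$ for some fixed $q\geq1$. Let $x\in[a,b]$, $\lambda\in[0,1]$, $\alpha>0$. Then $$|S_{f}(mx,\lambda,\alpha,ma,mb)|\leq A_{1}(\alpha,\lambda)^{1-\frac1q}\Big\{\frac{m^{\alpha}(x-a)^{\alpha+1}}{b-a}\big(|f'(mx)|^{q}A_{2}(\alpha,\lambda)+m|f'(a)|^{q}A_{3}(\alpha,\lambda)\big)^{\frac1q}+\frac{m^{\alpha}(b-x)^{\alpha+1}}{b-a}\big(|f'(mx)|^{q}A_{2}(\alpha,\lambda)+m|f'(b)|^{q}A_{3}(\alpha,\lambda)\big)^{\frac1q}\Big\},$$ where $$A_{1}(\alpha,\lambda)=\frac{2\alpha\lambda^{1+\frac1\alpha}+1}{\alpha+1}-\lambda,\qquad A_{2}(\alpha,\lambda)=\frac{\alpha\lambda^{1+\frac2\alpha}+1}{\alpha+2}-\frac{\lambda}{2},$$ $$A_{3}(\alpha,\lambda)=\frac{2\alpha\lambda^{1+\frac1\alpha}+1}{\alpha+1}-\frac{\alpha\lambda^{1+\frac2\alpha}+1}{\alpha+2}-\frac{\lambda}{2}.$$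
   Context: Here "$g$ is $m$-convex on $[ma,mb]$" means $g(tu+m(1-t)v)\le t\,g(u)+m(1-t)\,g(v)$ for all $t\in[0,1]$ and all $u,v$ with $u\in[ma,mb]$ and $mv\in[ma,mb]$ (i.e. $v\in[a,b]$), so that the point $tu+m(1-t)v$ lies in $[ma,mb]$. $\Gamma$ is the Euler Gamma function. For $c<d$, $y\in[c,d]$, $\alpha>0$: $J_{y^{-}}^{\alpha}f(c)=\frac{1}{\Gamma(\alpha)}\int_{c}^{y}(t-c)^{\alpha-1}f(t)\,dt$ and $J_{y^{+}}^{\alpha}f(d)=\frac{1}{\Gamma(\alpha)}\int_{y}^{d}(d-t)^{\alpha-1}f(t)\,dt$ (equal to $0$ when the interval of integration is a single point), and $$S_{f}(y,\lambda,\alpha,c,d)=(1-\lambda)\frac{(y-c)^{\alpha}+(d-y)^{\alpha}}{d-c}f(y)+\lambda\frac{(y-c)^{\alpha}f(c)+(d-y)^{\alpha}f(d)}{d-c}-\frac{\Gamma(\alpha+1)}{d-c}\left[J_{y^{-}}^{\alpha}f(c)+J_{y^{+}}^{\alpha}f(d)\right].$$ *)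

theory Defs
  imports "HOL-Analysis.Analysis"
begin

text \<open>
  The arguments of \<open>g\<close> on the right-hand side range over \<open>[c, d]\<close> (for \<open>u\<close>) and over the
  rescaled interval \<open>[c / m, d / m]\<close> (for \<open>v\<close>), so \<open>g\<close> is in general also evaluated outside
  \<open>[c, d]\<close>.
\<close>
definition m_convex_on :: "real \<Rightarrow> real \<Rightarrow> real \<Rightarrow> (real \<Rightarrow> real) \<Rightarrow> bool" where
  "m_convex_on m c d g \<longleftrightarrow>
     (\<forall>t\<in>{0..1}. \<forall>u v. u \<in> {c..d} \<longrightarrow> m * v \<in> {c..d} \<longrightarrow>
        g (t * u + m * (1 - t) * v) \<le> t * g u + m * (1 - t) * g v)"

text \<open>
  Riemann--Liouville fractional integrals of order \<open>\<alpha>\<close>: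
  \<open>RL_minus \<alpha> y f c\<close> is $J_{y^-}^{\alpha} f(c)$ for \<open>c \<le> y\<close>, and
  \<open>RL_plus \<alpha> y f d\<close> is $J_{y^+}^{\alpha} f(d)$ for \<open>y \<le> d\<close>.
  Both vanish when the interval of integration is a single point, since points are null sets.
\<close>
definition RL_minus :: "real \<Rightarrow> real \<Rightarrow> (real \<Rightarrow> real) \<Rightarrow> real \<Rightarrow> real" where
  "RL_minus \<alpha> y f c =
     1 / Gamma \<alpha> * (LINT t:{c..y}|lebesgue. (t - c) powr (\<alpha> - 1) * f t)"

definition RL_plus :: "real \<Rightarrow> real \<Rightarrow> (real \<Rightarrow> real) \<Rightarrow> real \<Rightarrow> real" where
  "RL_plus \<alpha> y f d =
     1 / Gamma \<alpha> * (LINT t:{y..d}|lebesgue. (d - t) powr (\<alpha> - 1) * f t)"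

definition S :: "(real \<Rightarrow> real) \<Rightarrow> real \<Rightarrow> real \<Rightarrow> real \<Rightarrow> real \<Rightarrow> real \<Rightarrow> real" where
  "S f y l \<alpha> c d =
     (1 - l) * (((y - c) powr \<alpha> + (d - y) powr \<alpha>) / (d - c)) * f y
     + l * (((y - c) powr \<alpha> * f c + (d - y) powr \<alpha> * f d) / (d - c))
     - Gamma (\<alpha> + 1) / (d - c) * (RL_minus \<alpha> y f c + RL_plus \<alpha> y f d)"

definition A1 :: "real \<Rightarrow> real \<Rightarrow> real" where
  "A1 \<alpha> l = (2 * \<alpha> * l powr (1 + 1 / \<alpha>) + 1) / (\<alpha> + 1) - l"

definition A2 :: "real \<Rightarrow> real \<Rightarrow> real" where
  "A2 \<alpha> l = (\<alpha> * l powr (1 + 2 / \<alpha>) + 1) / (\<alpha> + 2) - l / 2"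

definition A3 :: "real \<Rightarrow> real \<Rightarrow> real" where
  "A3 \<alpha> l =
     (2 * \<alpha> * l powr (1 + 1 / \<alpha>) + 1) / (\<alpha> + 1)
     - (\<alpha> * l powr (1 + 2 / \<alpha>) + 1) / (\<alpha> + 2) - l / 2"

end

theory Submission
  imports Defs
begin

text \<open>
  On each side of \<open>y = m x\<close>, integrating \<open>((t - c)\<^sup>\<alpha> - \<lambda> (y - c)\<^sup>\<alpha>) f'(t)\<close> by parts produces the
  corresponding half of \<open>S\<close>. After rescaling to \<open>[0, 1]\<close>, \<open>m\<close>-convexity bounds \<open>|f'|\<close> by the
  \<open>q\<close>-th root of an affine function, and the power mean inequality for the weight \<open>|t\<^sup>\<alpha> - \<lambda>|\<close>
  finishes the estimate: \<open>A1\<close>, \<open>A2\<close>, \<open>A3\<close> are its integrals against \<open>1\<close>, \<open>t\<close> and \<open>1 - t\<close>.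
\<close>

section \<open>Moments of the weight |t^\<alpha> - l| on [0, 1]\<close>

lemma continuous_on_powr_const:
  fixes r :: real
  assumes "0 < r" and "X \<subseteq> {0..}"
  shows "continuous_on X (\<lambda>t. t powr r)"
  using assms by (intro continuous_on_powr') (auto intro!: continuous_intros)

text \<open>The difference t^\<alpha> - l can change sign only at
  \<open>s = l powr (1 / \<alpha>)\<close>, so with \<open>F\<close> an antiderivative of the
  integrand without absolute value, the integral is F 1 - 2 F s + F 0. The cases n = 0 and n = 1
  yield \<open>A1\<close> and \<open>A2\<close>.\<close>

lemma has_integral_abs_powr_diff:
  fixes \<alpha> l :: real and n :: nat
  assumes "0 < \<alpha>" and "0 \<le> l" and "l \<le> 1"
  shows "((\<lambda>t. \<bar>t powr \<alpha> - l\<bar> * t ^ n) has_integral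
    1 / (\<alpha> + real n + 1) - l / (real n + 1)
    + 2 * \<alpha> * l powr (1 + (real n + 1) / \<alpha>) / ((real n + 1) * (\<alpha> + real n + 1))) {0..1}"
proof -
  define s where "s = l powr (1 / \<alpha>)"
  define F where "F t = t powr (\<alpha> + real n + 1) / (\<alpha> + real n + 1) - l * t ^ (n + 1) / (real n + 1)"
    for t
  have s: "0 \<le> s" "s \<le> 1" "s powr \<alpha> = l"
    using assms by (auto simp: s_def powr_powr powr_le1)
  have pos: "0 < \<alpha> + real n + 1" "0 < real n + 1"
    using assms by auto
  have cont: "continuous_on A F" if "A \<subseteq> {0..}" for A
    unfolding F_def using that pos by (intro continuous_intros continuous_on_powr_const) auto
  have deriv: "(F has_real_derivative (t powr \<alpha> - l) * t ^ n) (at t)" if "0 < t" for t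
  proof -
    have "t powr (\<alpha> + real n) = t powr \<alpha> * t ^ n"
      using that by (simp add: powr_add powr_realpow)
    moreover have "((\<lambda>t. t powr (\<alpha> + real n + 1) / (\<alpha> + real n + 1)) has_real_derivative
        t powr (\<alpha> + real n)) (at t)"
      using DERIV_cdivide[OF has_real_derivative_powr[OF that], of "\<alpha> + real n + 1" "\<alpha> + real n + 1"] pos
      by simp
    moreover have "((\<lambda>t. l * t ^ (n + 1) / (real n + 1)) has_real_derivative l * t ^ n) (at t)"
      using DERIV_cdivide[OF DERIV_cmult[OF DERIV_pow[of "n + 1" t UNIV]], of l "real n + 1"] pos
      by (simp add: add.commute)
    ultimately show ?thesis
      unfolding F_def left_diff_distrib by (auto intro: DERIV_diff)
  qed
  have left: "((\<lambda>t. \<bar>t powr \<alpha> - l\<bar> * t ^ n) has_integral (- F s - - F 0)) {0..s}"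
  proof (rule fundamental_theorem_of_calculus_interior)
    show "((\<lambda>t. - F t) has_vector_derivative \<bar>t powr \<alpha> - l\<bar> * t ^ n) (at t)"
      if "t \<in> {0<..<s}" for t
    proof -
      have "t powr \<alpha> \<le> s powr \<alpha>"
        using that assms by (intro powr_mono2) auto
      then have "\<bar>t powr \<alpha> - l\<bar> * t ^ n = - ((t powr \<alpha> - l) * t ^ n)"
        using s by (simp flip: mult_minus_left)
      then show ?thesis
        using that DERIV_minus[OF deriv] by (simp add: has_real_derivative_iff_has_vector_derivative)
    qed
  qed (use s in \<open>auto intro!: continuous_intros cont\<close>)
  have right: "((\<lambda>t. \<bar>t powr \<alpha> - l\<bar> * t ^ n) has_integral (F 1 - F s)) {s..1}"
  proof (rule fundamental_theorem_of_calculus_interior)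
    show "(F has_vector_derivative \<bar>t powr \<alpha> - l\<bar> * t ^ n) (at t)"
      if "t \<in> {s<..<1}" for t
    proof -
      have "s powr \<alpha> \<le> t powr \<alpha>"
        using that assms s by (intro powr_mono2) auto
      then have "\<bar>t powr \<alpha> - l\<bar> * t ^ n = (t powr \<alpha> - l) * t ^ n"
        using s by simp
      then show ?thesis
        using that s deriv by (simp add: has_real_derivative_iff_has_vector_derivative)
    qed
  qed (use s in \<open>auto intro!: continuous_intros cont\<close>)
  define L where "L = l powr (1 + (real n + 1) / \<alpha>)"
  \<comment> \<open>Both terms of \<open>F s\<close> reduce to the same power of l. The power laws
    used need a positive base; for l = 0 the convention \<open>0 powr r = 0\<close> makes all three
    expressions 0.\<close>
  have "l * s ^ (n + 1) = L \<and> s powr (\<alpha> + real n + 1) = L"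
  proof (cases "l = 0")
    case False
    then have "0 < l"
      using assms by simp
    then have "s ^ (n + 1) = l powr ((real n + 1) / \<alpha>)"
      using powr_realpow[of s "n + 1"] by (simp add: s_def powr_powr add.commute)
    then have "l * s ^ (n + 1) = L"
      using \<open>0 < l\<close> by (simp add: L_def powr_add[of l 1 "(real n + 1) / \<alpha>"])
    moreover have "1 / \<alpha> * (\<alpha> + real n + 1) = 1 + (real n + 1) / \<alpha>"
      using assms by (simp add: field_simps)
    then have "s powr (\<alpha> + real n + 1) = L"
      by (simp only: s_def L_def powr_powr)
    ultimately show ?thesis ..
  qed (simp add: s_def L_def)
  then have "F s = L / (\<alpha> + real n + 1) - L / (real n + 1)"
    by (simp add: F_def)
  moreover have "F 0 = 0" "F 1 = 1 / (\<alpha> + real n + 1) - l / (real n + 1)"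
    using pos by (auto simp: F_def)
  ultimately have "(- F s - - F 0) + (F 1 - F s)
    = 1 / (\<alpha> + real n + 1) - l / (real n + 1) + 2 * \<alpha> * L / ((real n + 1) * (\<alpha> + real n + 1))"
    using pos by (simp add: divide_simps) (simp add: algebra_simps)
  then show ?thesis
    using has_integral_combine[OF s(1,2) left right] by (simp add: L_def)
qed

lemma has_integral_A1:
  assumes "0 < \<alpha>" and "0 \<le> l" and "l \<le> 1"
  shows "((\<lambda>t. \<bar>t powr \<alpha> - l\<bar>) has_integral A1 \<alpha> l) {0..1}"
  using has_integral_abs_powr_diff[OF assms, of 0]
  by (simp add: A1_def add_divide_distrib algebra_simps)

lemma has_integral_A2:
  assumes "0 < \<alpha>" and "0 \<le> l" and "l \<le> 1"
  shows "((\<lambda>t. \<bar>t powr \<alpha> - l\<bar> * t) has_integral A2 \<alpha> l) {0..1}"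
proof -
  have "1 / (\<alpha> + real 1 + 1) - l / (real 1 + 1)
      + 2 * \<alpha> * l powr (1 + (real 1 + 1) / \<alpha>) / ((real 1 + 1) * (\<alpha> + real 1 + 1)) = A2 \<alpha> l"
    using assms(1) by (simp add: A2_def divide_simps) (simp add: algebra_simps)
  then show ?thesis
    using has_integral_abs_powr_diff[OF assms, of 1] by (simp only: power_one_right)
qed

text \<open>Since t + (1 - t) = 1, this exhibits \<open>A3\<close> as the integral of the weight
  against 1 - t.\<close>

lemma A3_eq: "A3 \<alpha> l = A1 \<alpha> l - A2 \<alpha> l"
  by (simp add: A1_def A2_def A3_def)

lemma has_integral_weight:
  assumes "0 < \<alpha>" and "0 \<le> l" and "l \<le> 1"
  shows "((\<lambda>t. \<bar>t powr \<alpha> - l\<bar> * (t * P + (1 - t) * Q)) has_integral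
    P * A2 \<alpha> l + Q * A3 \<alpha> l) {0..1}"
proof -
  \<comment> \<open>The affine factor is rewritten as (P - Q) t + Q, which leaves only the moments
    \<open>A1\<close> and \<open>A2\<close>.\<close>
  have "((\<lambda>t. (P - Q) * (\<bar>t powr \<alpha> - l\<bar> * t) + Q * \<bar>t powr \<alpha> - l\<bar>) has_integral
    (P - Q) * A2 \<alpha> l + Q * A1 \<alpha> l) {0..1}"
    by (intro has_integral_add has_integral_mult_right has_integral_A1 has_integral_A2 assms)
  then show ?thesis
    by (simp add: A3_eq algebra_simps)
qed

section \<open>Power mean inequality\<close>

text \<open>Integrating Young's inequality \<open>u\<^sup>1\<^sup>/\<^sup>q v\<^sup>1\<^sup>-\<^sup>1\<^sup>/\<^sup>q \<le> u / q + (1 - 1 / q) v\<close> against the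
  weight, with \<open>v\<close> the weighted mean of \<open>u\<close>, gives the power mean inequality.\<close>
lemma weighted_power_mean:
  fixes w u :: "real \<Rightarrow> real"
  assumes "1 \<le> q" and "continuous_on {0..1} w" and "continuous_on {0..1} u"
    and w: "\<And>t. t \<in> {0..1} \<Longrightarrow> 0 \<le> w t" and u: "\<And>t. t \<in> {0..1} \<Longrightarrow> 0 \<le> u t"
    and W: "(w has_integral W) {0..1}" and U: "((\<lambda>t. w t * u t) has_integral U) {0..1}"
  shows "integral {0..1} (\<lambda>t. w t * u t powr (1 / q)) \<le> W powr (1 - 1 / q) * U powr (1 / q)"
proof -
  have "0 \<le> U" "0 \<le> W"
    using has_integral_nonneg[OF U] has_integral_nonneg[OF W] w u by auto
  have cont: "continuous_on {0..1} (\<lambda>t. w t * u t)"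
    by (intro continuous_intros assms)
  show ?thesis
  proof (cases "U = 0")
    case True
    \<comment> \<open>A continuous nonnegative function with integral 0 vanishes pointwise; so
      \<open>w t = 0\<close> or \<open>u t = 0\<close>, and the root of \<open>u t\<close> keeps the
      zero.\<close>
    have "w t * u t = 0" if "t \<in> {0..1}" for t
      using has_integral_0_cbox_imp_0[of 0 1 "\<lambda>t. w t * u t" t] cont U True w u that by auto
    then have "w t * u t powr (1 / q) = 0" if "t \<in> {0..1}" for t
      using that by fastforce
    then have "((\<lambda>t. w t * u t powr (1 / q)) has_integral 0) {0..1}"
      by (intro has_integral_is_0) auto
    with True show ?thesis
      by (simp add: integral_unique)
  next
    case False
    with \<open>0 \<le> U\<close> have "0 < U"
      by simp
    \<comment> \<open>This makes the mean \<open>U / W\<close> meaningful: if \<open>W\<close> were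
      0, the continuous nonnegative \<open>w\<close> would vanish and \<open>U\<close> with
      it.\<close>
    have "W \<noteq> 0"
    proof
      assume "W = 0"
      then have "w t = 0" if "t \<in> {0..1}" for t
        using has_integral_0_cbox_imp_0[of 0 1 w t] W w assms(2) that by auto
      then have "((\<lambda>t. w t * u t) has_integral 0) {0..1}"
        by (intro has_integral_is_0) auto
      then show False
        using U False has_integral_unique by blast
    qed
    with \<open>0 \<le> W\<close> have "0 < W"
      by simp
    define v where "v = U / W"
    have "0 < v"
      using \<open>0 < U\<close> \<open>0 < W\<close> by (simp add: v_def)
    have "v * W = U"
      using \<open>0 < W\<close> by (simp add: v_def)
    \<comment> \<open>\<open>Youngs_inequality_0\<close> needs positive arguments; for
      \<open>u t = 0\<close> the left side vanishes because
      \<open>0 powr (1 / q) = 0\<close>.\<close>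
    have young: "u t powr (1 / q) * v powr (1 - 1 / q) \<le> 1 / q * u t + (1 - 1 / q) * v"
      if "t \<in> {0..1}" for t
    proof (cases "u t = 0")
      case True
      then show ?thesis
        using assms(1) \<open>0 < v\<close> by simp
    next
      case False
      then show ?thesis
        using u[OF that] assms(1) \<open>0 < v\<close> by (intro Youngs_inequality_0) auto
    qed
    have "v powr (1 - 1 / q) * integral {0..1} (\<lambda>t. w t * u t powr (1 / q))
      = integral {0..1} (\<lambda>t. w t * (u t powr (1 / q) * v powr (1 - 1 / q)))"
      by (subst Henstock_Kurzweil_Integration.integral_mult_right[symmetric]) (simp only: mult_ac)
    also have "\<dots> \<le> integral {0..1} (\<lambda>t. 1 / q * (w t * u t) + (1 - 1 / q) * v * w t)"
    proof (rule integral_le)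
      show "(\<lambda>t. w t * (u t powr (1 / q) * v powr (1 - 1 / q))) integrable_on {0..1}"
        by (intro integrable_continuous_real continuous_on_mult continuous_on_const assms
            continuous_on_powr') (use u assms(1) in auto)
      show "(\<lambda>t. 1 / q * (w t * u t) + (1 - 1 / q) * v * w t) integrable_on {0..1}"
        by (intro integrable_continuous_real continuous_intros assms)
      show "w t * (u t powr (1 / q) * v powr (1 - 1 / q)) \<le> 1 / q * (w t * u t) + (1 - 1 / q) * v * w t"
        if "t \<in> {0..1}" for t
        using mult_left_mono[OF young[OF that] w[OF that]] by (simp add: algebra_simps)
    qed
    also have "\<dots> = 1 / q * U + (1 - 1 / q) * v * W"
      by (intro integral_unique has_integral_add has_integral_mult_right U W)
    also have "\<dots> = U"
      using \<open>v * W = U\<close> by (simp add: mult.assoc left_diff_distrib)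
    finally have le: "v powr (1 - 1 / q) * integral {0..1} (\<lambda>t. w t * u t powr (1 / q)) \<le> U" .
    \<comment> \<open>The claim is compared after multiplication by v^(1 - 1/q):
      \<open>v * W = U\<close> then turns its right side into \<open>U\<close>, and the positive
      factor cancels.\<close>
    have "v powr (1 - 1 / q) * (W powr (1 - 1 / q) * U powr (1 / q)) = U powr (1 - 1 / q + 1 / q)"
      using \<open>0 < v\<close> \<open>0 < W\<close> by (simp only: powr_add mult.assoc \<open>v * W = U\<close>[symmetric] powr_mult)
    also have "\<dots> = U"
      using \<open>0 < U\<close> by simp
    finally have "v powr (1 - 1 / q) * integral {0..1} (\<lambda>t. w t * u t powr (1 / q))
        \<le> v powr (1 - 1 / q) * (W powr (1 - 1 / q) * U powr (1 / q))"
      using le by (simp only:)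
    then show ?thesis
      by (rule mult_left_le_imp_le) (use \<open>0 < v\<close> in simp)
  qed
qed

section \<open>Fractional integration by parts on [0, 1]\<close>

text \<open>For \<alpha> < 1 the kernel is unbounded at 0 but integrable, as \<alpha> - 1 > -1; a
  continuous factor on a compact interval is bounded and measurable.\<close>

lemma absolutely_integrable_powr_mult:
  fixes \<phi> :: "real \<Rightarrow> real"
  assumes "0 < \<alpha>" and "continuous_on {0..1} \<phi>"
  shows "(\<lambda>t. t powr (\<alpha> - 1) * \<phi> t) absolutely_integrable_on {0..1}"
proof -
  have "(\<lambda>t::real. t powr (\<alpha> - 1)) absolutely_integrable_on {0..1}"
    using assms by (intro nonnegative_absolutely_integrable_1 integrable_on_powr_from_0) auto
  then have "(\<lambda>t. \<phi> t * t powr (\<alpha> - 1)) absolutely_integrable_on {0..1}"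
    using assms(2)
    by (intro absolutely_integrable_bounded_measurable_product_real
        continuous_imp_measurable_on_sets_lebesgue compact_imp_bounded compact_continuous_image) auto
  then show ?thesis
    by (simp add: mult.commute)
qed

text \<open>Integration by parts with the primitive t^\<alpha> - l of \<alpha> t^(\<alpha> - 1): the
  shift by l gives the boundary weights 1 - l at 1 and l at 0. The fundamental theorem integrates
  the whole derivative of the product; subtracting the integrable kernel term leaves the gauge
  integral of the \<open>\<phi>'\<close> term.\<close>

lemma fractional_montgomery_identity:
  fixes \<phi> \<phi>' :: "real \<Rightarrow> real"
  assumes "0 < \<alpha>" and cont: "continuous_on {0..1} \<phi>"
    and deriv: "\<And>t. t \<in> {0<..<1} \<Longrightarrow> (\<phi> has_real_derivative \<phi>' t) (at t)"
  shows "((\<lambda>t. (t powr \<alpha> - l) * \<phi>' t) has_integral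
    (1 - l) * \<phi> 1 + l * \<phi> 0 - \<alpha> * integral {0..1} (\<lambda>t. t powr (\<alpha> - 1) * \<phi> t)) {0..1}"
proof -
  have "((\<lambda>t. \<alpha> * (t powr (\<alpha> - 1) * \<phi> t) + (t powr \<alpha> - l) * \<phi>' t) has_integral
      (1 powr \<alpha> - l) * \<phi> 1 - (0 powr \<alpha> - l) * \<phi> 0) {0..1}"
  proof (rule fundamental_theorem_of_calculus_interior)
    show "continuous_on {0..1} (\<lambda>t. (t powr \<alpha> - l) * \<phi> t)"
      using assms by (intro continuous_intros continuous_on_powr_const) auto
    show "((\<lambda>t. (t powr \<alpha> - l) * \<phi> t) has_vector_derivative
        \<alpha> * (t powr (\<alpha> - 1) * \<phi> t) + (t powr \<alpha> - l) * \<phi>' t) (at t)" if "t \<in> {0<..<1}" for t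
      unfolding has_real_derivative_iff_has_vector_derivative[symmetric]
      using that by (auto intro!: derivative_eq_intros deriv simp: algebra_simps)
  qed simp
  moreover have "((\<lambda>t. \<alpha> * (t powr (\<alpha> - 1) * \<phi> t)) has_integral
      \<alpha> * integral {0..1} (\<lambda>t. t powr (\<alpha> - 1) * \<phi> t)) {0..1}"
    using absolutely_integrable_powr_mult[OF assms(1) cont]
    by (intro has_integral_mult_right integrable_integral set_lebesgue_integral_eq_integral)
  ultimately have "((\<lambda>t. (\<alpha> * (t powr (\<alpha> - 1) * \<phi> t) + (t powr \<alpha> - l) * \<phi>' t)
        - \<alpha> * (t powr (\<alpha> - 1) * \<phi> t)) has_integral
      (1 powr \<alpha> - l) * \<phi> 1 - (0 powr \<alpha> - l) * \<phi> 0
        - \<alpha> * integral {0..1} (\<lambda>t. t powr (\<alpha> - 1) * \<phi> t)) {0..1}"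
    by (rule has_integral_diff)
  then show ?thesis
    using assms(1) by simp
qed

text \<open>The identity turns the left side into an integral of \<open>\<phi>'\<close>, which is
  dominated by the weight times the q-th root of the affine bound; the power mean inequality then
  applies. The factor \<open>k\<close> is kept apart for the chain rule, so that
  \<open>bound\<close> concerns the unscaled derivative.\<close>

lemma fractional_montgomery_bound:
  fixes \<phi> \<phi>' :: "real \<Rightarrow> real"
  assumes "0 < \<alpha>" and "0 \<le> l" and "l \<le> 1" and "1 \<le> q" and "0 \<le> P" and "0 \<le> Q"
    and cont: "continuous_on {0..1} \<phi>"
    and deriv: "\<And>t. t \<in> {0<..<1} \<Longrightarrow> (\<phi> has_real_derivative k * \<phi>' t) (at t)"
    and bound: "\<And>t. t \<in> {0..1} \<Longrightarrow> \<bar>\<phi>' t\<bar> powr q \<le> t * P + (1 - t) * Q"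
  shows "\<bar>(1 - l) * \<phi> 1 + l * \<phi> 0 - \<alpha> * integral {0..1} (\<lambda>t. t powr (\<alpha> - 1) * \<phi> t)\<bar>
    \<le> \<bar>k\<bar> * (A1 \<alpha> l powr (1 - 1 / q) * (P * A2 \<alpha> l + Q * A3 \<alpha> l) powr (1 / q))"
proof -
  define u where "u t = t * P + (1 - t) * Q" for t
  have u: "0 \<le> u t" if "t \<in> {0..1}" for t
    using that assms by (auto simp: u_def)
  have contw: "continuous_on {0..1} (\<lambda>t. \<bar>t powr \<alpha> - l\<bar>)"
    using assms by (intro continuous_intros continuous_on_powr_const) auto
  have contu: "continuous_on {0..1} u"
    unfolding u_def by (intro continuous_intros)
  note id = fractional_montgomery_identity[OF assms(1) cont deriv, of l]
  have root: "\<bar>\<phi>' t\<bar> \<le> u t powr (1 / q)" if "t \<in> {0..1}" for t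
  proof -
    have "(\<bar>\<phi>' t\<bar> powr q) powr (1 / q) \<le> u t powr (1 / q)"
      using bound[OF that] assms(4) by (intro powr_mono2) (auto simp: u_def)
    then show ?thesis
      using assms(4) by (simp add: powr_powr)
  qed
  have "norm (integral {0..1} (\<lambda>t. (t powr \<alpha> - l) * (k * \<phi>' t)))
    \<le> integral {0..1} (\<lambda>t. \<bar>k\<bar> * (\<bar>t powr \<alpha> - l\<bar> * u t powr (1 / q)))"
  proof (rule integral_norm_bound_integral)
    show "(\<lambda>t. \<bar>k\<bar> * (\<bar>t powr \<alpha> - l\<bar> * u t powr (1 / q))) integrable_on {0..1}"
      by (intro integrable_continuous_real continuous_on_mult continuous_on_const contw
          continuous_on_powr' contu) (use u assms(4) in auto)
    show "norm ((t powr \<alpha> - l) * (k * \<phi>' t)) \<le> \<bar>k\<bar> * (\<bar>t powr \<alpha> - l\<bar> * u t powr (1 / q))"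
      if "t \<in> {0..1}" for t
      using mult_left_mono[OF root[OF that], of "\<bar>k\<bar> * \<bar>t powr \<alpha> - l\<bar>"]
      by (simp add: abs_mult mult_ac)
  qed (use id in \<open>auto simp: integrable_on_def\<close>)
  also have "\<dots> = \<bar>k\<bar> * integral {0..1} (\<lambda>t. \<bar>t powr \<alpha> - l\<bar> * u t powr (1 / q))"
    by simp
  also have "\<dots> \<le> \<bar>k\<bar> * (A1 \<alpha> l powr (1 - 1 / q) * (P * A2 \<alpha> l + Q * A3 \<alpha> l) powr (1 / q))"
    using has_integral_A1[of \<alpha> l] has_integral_weight[of \<alpha> l P Q] assms u contw contu
    by (intro mult_left_mono weighted_power_mean) (auto simp: u_def)
  finally show ?thesis
    using integral_unique[OF id] by simp
qed

section \<open>Transfer to the segment between an endpoint and y\<close>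

text \<open>The parametrisation \<open>e + t (y - e)\<close> covers both fractional integrals: \<open>e\<close> is the
  endpoint carrying the singular kernel, to the left or to the right of \<open>y\<close>.\<close>
lemma fractional_integral_segment:
  fixes f :: "real \<Rightarrow> real"
  assumes "0 < \<alpha>" and "e \<noteq> y" and cont: "continuous_on (closed_segment e y) f"
  shows "(LINT s:closed_segment e y|lebesgue. \<bar>s - e\<bar> powr (\<alpha> - 1) * f s)
    = \<bar>y - e\<bar> powr \<alpha> * integral {0..1} (\<lambda>t. t powr (\<alpha> - 1) * f (e + t * (y - e)))"
proof -
  let ?g = "\<lambda>t. e + t * (y - e)"
  let ?F = "\<lambda>s. \<bar>s - e\<bar> powr (\<alpha> - 1) * f s"
  let ?h = "\<lambda>t. t powr (\<alpha> - 1) * f (?g t)"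
  have img: "?g ` {0..1} = closed_segment e y"
    unfolding closed_segment_image_interval by (intro image_cong) (auto simp: algebra_simps)
  \<comment> \<open>With s = e + t (y - e) one has |s - e| = t |y - e|, and the Jacobian |y - e|
    raises the exponent of |y - e| from \<alpha> - 1 to \<alpha>.\<close>
  have eq: "\<bar>y - e\<bar> * ?F (?g t) = \<bar>y - e\<bar> powr \<alpha> * ?h t" if "t \<in> {0..1}" for t
    using that assms(2) by (simp add: abs_mult powr_mult powr_diff)
  have "?h absolutely_integrable_on {0..1}"
    using assms(1) cont img
    by (intro absolutely_integrable_powr_mult continuous_on_compose2[OF cont] continuous_intros) auto
  then have "(\<lambda>t. \<bar>y - e\<bar> powr \<alpha> * ?h t) absolutely_integrable_on {0..1}"
    by (rule set_integrable_mult_right)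
  moreover have "(\<lambda>t. \<bar>y - e\<bar> powr \<alpha> * ?h t) absolutely_integrable_on {0..1} \<longleftrightarrow>
    (\<lambda>t. \<bar>y - e\<bar> * ?F (?g t)) absolutely_integrable_on {0..1}"
    by (rule set_integrable_cong[OF refl refl]) (rule eq[symmetric])
  ultimately have "(\<lambda>t. \<bar>y - e\<bar> * ?F (?g t)) absolutely_integrable_on {0..1}"
    by simp
  moreover have "integral {0..1} (\<lambda>t. \<bar>y - e\<bar> * ?F (?g t)) = \<bar>y - e\<bar> powr \<alpha> * integral {0..1} ?h"
    by (subst integral_mult_right[symmetric]) (intro Henstock_Kurzweil_Integration.integral_cong eq)
  moreover have "inj_on ?g {0..1}"
    using assms(2) by (auto simp: inj_on_def)
  moreover have "(?g has_field_derivative y - e) (at t within {0..1})" for t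
    by (auto intro!: derivative_eq_intros)
  \<comment> \<open>The Jacobian enters in absolute value, so y < e is covered too. Absolute
    integrability on the segment identifies the Lebesgue integral with the gauge integral.\<close>
  ultimately have "?F absolutely_integrable_on ?g ` {0..1} \<and>
    integral (?g ` {0..1}) ?F = \<bar>y - e\<bar> powr \<alpha> * integral {0..1} ?h"
    using has_absolute_integral_change_of_variables_1'[of "{0..1}" ?g "\<lambda>_. y - e" ?F] by auto
  then show ?thesis
    unfolding img using set_lebesgue_integral_eq_integral(2)[of "closed_segment e y" ?F] by simp
qed

text \<open>The chain rule gives \<open>k = y - e\<close>, which together with the factor |y -
  e|^\<alpha> of the rescaled integral makes the exponent \<alpha> + 1. The bound \<open>P\<close>
  belongs to y (t = 1) and \<open>Q\<close> to e (t = 0).\<close>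

lemma fractional_montgomery_bound_segment:
  fixes f f' :: "real \<Rightarrow> real"
  assumes "0 < \<alpha>" and "0 \<le> l" and "l \<le> 1" and "1 \<le> q" and "0 \<le> P" and "0 \<le> Q"
    and deriv: "\<And>s. s \<in> closed_segment e y \<Longrightarrow> (f has_real_derivative f' s) (at s)"
    and bound: "\<And>t. t \<in> {0..1} \<Longrightarrow> \<bar>f' (e + t * (y - e))\<bar> powr q \<le> t * P + (1 - t) * Q"
  shows "\<bar>\<bar>y - e\<bar> powr \<alpha> * ((1 - l) * f y + l * f e)
      - \<alpha> * (LINT s:closed_segment e y|lebesgue. \<bar>s - e\<bar> powr (\<alpha> - 1) * f s)\<bar>
    \<le> \<bar>y - e\<bar> powr (\<alpha> + 1) * (A1 \<alpha> l powr (1 - 1 / q) * (P * A2 \<alpha> l + Q * A3 \<alpha> l) powr (1 / q))"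
proof (cases "e = y")
  case True
  \<comment> \<open>At the only point of the segment the kernel is
    \<open>0 powr (\<alpha> - 1)\<close>, which is 0 for every exponent, so both sides of the claim
    vanish.\<close>
  then have "(\<lambda>s. indicator (closed_segment e y) s *\<^sub>R (\<bar>s - e\<bar> powr (\<alpha> - 1) * f s)) = (\<lambda>_. 0)"
    by (auto simp: indicator_def fun_eq_iff)
  with True show ?thesis
    using assms(1) by (simp add: set_lebesgue_integral_def)
next
  case False
  let ?g = "\<lambda>t. e + t * (y - e)"
  let ?R = "A1 \<alpha> l powr (1 - 1 / q) * (P * A2 \<alpha> l + Q * A3 \<alpha> l) powr (1 / q)"
  have cont: "continuous_on (closed_segment e y) f"
    by (meson deriv DERIV_isCont continuous_at_imp_continuous_on)
  have seg: "?g t \<in> closed_segment e y" if "t \<in> {0..1}" for t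
    using that by (auto simp: closed_segment_def algebra_simps intro!: exI[of _ t])
  have "((\<lambda>t. f (?g t)) has_real_derivative (y - e) * f' (?g t)) (at t)" if "t \<in> {0<..<1}" for t
  proof -
    have "(?g has_real_derivative y - e) (at t)"
      by (auto intro!: derivative_eq_intros)
    then show ?thesis
      using DERIV_chain2[where f = f and g = ?g and x = t, OF deriv[OF seg]] that
      by (simp add: mult.commute)
  qed
  moreover have "continuous_on {0..1} (\<lambda>t. f (?g t))"
    using seg by (intro continuous_on_compose2[OF cont] continuous_intros) auto
  ultimately have "\<bar>(1 - l) * f y + l * f e - \<alpha> * integral {0..1} (\<lambda>t. t powr (\<alpha> - 1) * f (?g t))\<bar>
      \<le> \<bar>y - e\<bar> * ?R"
    using fractional_montgomery_bound[OF assms(1-6), of "\<lambda>t. f (?g t)" "y - e" "\<lambda>t. f' (?g t)"] bound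
    by simp
  then have "\<bar>y - e\<bar> powr \<alpha> * \<bar>(1 - l) * f y + l * f e
      - \<alpha> * integral {0..1} (\<lambda>t. t powr (\<alpha> - 1) * f (?g t))\<bar> \<le> \<bar>y - e\<bar> powr \<alpha> * (\<bar>y - e\<bar> * ?R)"
    by (intro mult_left_mono) auto
  also have "\<dots> = \<bar>y - e\<bar> powr (\<alpha> + 1) * ?R"
    by (simp add: powr_add)
  also have "\<bar>y - e\<bar> powr \<alpha> * \<bar>(1 - l) * f y + l * f e
      - \<alpha> * integral {0..1} (\<lambda>t. t powr (\<alpha> - 1) * f (?g t))\<bar>
    = \<bar>\<bar>y - e\<bar> powr \<alpha> * ((1 - l) * f y + l * f e)
      - \<alpha> * (LINT s:closed_segment e y|lebesgue. \<bar>s - e\<bar> powr (\<alpha> - 1) * f s)\<bar>"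
    unfolding fractional_integral_segment[OF assms(1) False cont] mult.left_commute[of \<alpha>]
      right_diff_distrib[symmetric] by (simp add: abs_mult)
  finally show ?thesis .
qed

section \<open>Assembly of the two halves of \<open>S\<close>\<close>

text \<open>The recurrence Gamma(\<alpha> + 1) = \<alpha> Gamma(\<alpha>) cancels the normalisation
  of the fractional integrals and leaves the factor \<alpha>. Absolute values and segments give both
  halves one shape, so a single bound serves both.\<close>

lemma S_decomposition:
  assumes "0 < \<alpha>" and "c \<le> y" and "y \<le> d"
  shows "S f y l \<alpha> c d =
    ((\<bar>y - c\<bar> powr \<alpha> * ((1 - l) * f y + l * f c)
        - \<alpha> * (LINT s:closed_segment c y|lebesgue. \<bar>s - c\<bar> powr (\<alpha> - 1) * f s))
     + (\<bar>y - d\<bar> powr \<alpha> * ((1 - l) * f y + l * f d)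
        - \<alpha> * (LINT s:closed_segment d y|lebesgue. \<bar>s - d\<bar> powr (\<alpha> - 1) * f s))) / (d - c)"
proof -
  define Jc where "Jc = (LINT s:{c..y}|lebesgue. (s - c) powr (\<alpha> - 1) * f s)"
  define Jd where "Jd = (LINT s:{y..d}|lebesgue. (d - s) powr (\<alpha> - 1) * f s)"
  have "\<alpha> \<notin> \<int>\<^sub>\<le>\<^sub>0"
    using assms(1) nonpos_Ints_nonpos[of \<alpha>] by linarith
  then have "Gamma (\<alpha> + 1) = \<alpha> * Gamma \<alpha>" "Gamma \<alpha> \<noteq> 0"
    by (simp_all add: Gamma_plus1 Gamma_eq_zero_iff)
  then have "S f y l \<alpha> c d =
    (((y - c) powr \<alpha> * ((1 - l) * f y + l * f c) - \<alpha> * Jc)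
     + ((d - y) powr \<alpha> * ((1 - l) * f y + l * f d) - \<alpha> * Jd)) / (d - c)"
    unfolding S_def RL_minus_def RL_plus_def Jc_def[symmetric] Jd_def[symmetric]
    by (simp add: add_divide_distrib diff_divide_distrib algebra_simps)
  moreover have "(LINT s:closed_segment c y|lebesgue. \<bar>s - c\<bar> powr (\<alpha> - 1) * f s) = Jc"
    unfolding Jc_def using assms
    by (auto simp: closed_segment_eq_real_ivl intro!: set_lebesgue_integral_cong)
  moreover have "(LINT s:closed_segment d y|lebesgue. \<bar>s - d\<bar> powr (\<alpha> - 1) * f s) = Jd"
    unfolding Jd_def using assms
    by (auto simp: closed_segment_eq_real_ivl intro!: set_lebesgue_integral_cong)
  ultimately show ?thesis
    using assms by simp
qed

theorem theorem6:
  fixes I :: "real set" and f :: "real \<Rightarrow> real" and m a b q x l \<alpha> :: real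
  assumes "is_interval I" and "I \<subseteq> {0..}"
    and "f differentiable_on interior I"
    and "0 < m" and "m \<le> 1"
    and "a \<in> interior I" and "b \<in> interior I" and "a < b"
    and "m * a \<in> interior I" and "m * b \<in> interior I"
    and "set_integrable lebesgue {m * a..m * b} (deriv f)"
    and "q \<ge> 1"
    and "m_convex_on m (m * a) (m * b) (\<lambda>t. \<bar>deriv f t\<bar> powr q)"
    and "x \<in> {a..b}" and "l \<in> {0..1}" and "\<alpha> > 0"
  shows "\<bar>S f (m * x) l \<alpha> (m * a) (m * b)\<bar> \<le>
    A1 \<alpha> l powr (1 - 1 / q) *
    (m powr \<alpha> * (x - a) powr (\<alpha> + 1) / (b - a) *
       (\<bar>deriv f (m * x)\<bar> powr q * A2 \<alpha> l + m * \<bar>deriv f a\<bar> powr q * A3 \<alpha> l) powr (1 / q)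
     + m powr \<alpha> * (b - x) powr (\<alpha> + 1) / (b - a) *
       (\<bar>deriv f (m * x)\<bar> powr q * A2 \<alpha> l + m * \<bar>deriv f b\<bar> powr q * A3 \<alpha> l) powr (1 / q))"
proof -
  let ?y = "m * x"
  let ?P = "\<bar>deriv f ?y\<bar> powr q"
  \<comment> \<open>\<open>D e\<close> is the contribution of the endpoint m e: \<open>S\<close>
    equals (D a + D b) / (m b - m a).\<close>
  define D where "D e = \<bar>?y - m * e\<bar> powr \<alpha> * ((1 - l) * f ?y + l * f (m * e))
    - \<alpha> * (LINT s:closed_segment (m * e) ?y|lebesgue. \<bar>s - m * e\<bar> powr (\<alpha> - 1) * f s)" for e
  define R where "R e = (?P * A2 \<alpha> l + m * \<bar>deriv f e\<bar> powr q * A3 \<alpha> l) powr (1 / q)" for e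
  have y: "m * a \<le> ?y" "?y \<le> m * b"
    using assms by auto
  \<comment> \<open>The interior is again an interval, so it contains all of [ma, mb] along with the
    two ends, and \<open>f\<close> is differentiable at each of these points.\<close>
  have "is_interval (interior I)"
    using assms(1) by (simp add: is_interval_convex_1)
  then have deriv: "(f has_real_derivative deriv f s) (at s)" if "s \<in> {m * a..m * b}" for s
  proof -
    have "s \<in> interior I"
      using mem_is_interval_1_I[OF \<open>is_interval (interior I)\<close> assms(9,10)] that by simp
    then have "f differentiable at s"
      using assms(3) by (simp add: differentiable_on_eq_differentiable_at)
    then show ?thesis
      by (simp add: DERIV_deriv_iff_real_differentiable)
  qed
  have bound: "\<bar>D e\<bar> \<le> \<bar>?y - m * e\<bar> powr (\<alpha> + 1) * (A1 \<alpha> l powr (1 - 1 / q) * R e)"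
    if e: "e \<in> {a..b}" for e
    unfolding D_def R_def
  proof (rule fractional_montgomery_bound_segment)
    have me: "m * e \<in> {m * a..m * b}"
      using e assms(4) by auto
    show "(f has_real_derivative deriv f s) (at s)" if "s \<in> closed_segment (m * e) ?y" for s
      using that me y by (intro deriv) (auto simp: closed_segment_eq_real_ivl split: if_splits)
    show "\<bar>deriv f (m * e + t * (?y - m * e))\<bar> powr q \<le> t * ?P + (1 - t) * (m * \<bar>deriv f e\<bar> powr q)"
      if "t \<in> {0..1}" for t
    proof -
      \<comment> \<open>This is m-convexity at u = m x and v = e. It is the source of the factor m
        and of the value of f' at e rather than at m e.\<close>
      have "\<bar>deriv f (t * ?y + m * (1 - t) * e)\<bar> powr q \<le> t * ?P + m * (1 - t) * \<bar>deriv f e\<bar> powr q"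
        using assms(13) that me y unfolding m_convex_on_def by simp
      then show ?thesis
        by (simp add: algebra_simps)
    qed
  qed (use assms in auto)
  \<comment> \<open>One factor m is split off m^(\<alpha> + 1) to cancel against m b - m a = m (b -
    a); the m^\<alpha> of the claim remains.\<close>
  have scale: "\<bar>?y - m * e\<bar> powr (\<alpha> + 1) = m * (m powr \<alpha> * \<bar>x - e\<bar> powr (\<alpha> + 1))" for e
  proof -
    have "\<bar>?y - m * e\<bar> = m * \<bar>x - e\<bar>"
      using assms(4) by (simp add: abs_mult flip: right_diff_distrib)
    then show ?thesis
      using assms(4) by (simp add: powr_mult powr_add)
  qed
  let ?w = "A1 \<alpha> l powr (1 - 1 / q)"
  have Da: "\<bar>D a\<bar> \<le> m * (m powr \<alpha> * (x - a) powr (\<alpha> + 1)) * (?w * R a)"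
    using bound[of a] scale[of a] assms(8,14) by simp
  have Db: "\<bar>D b\<bar> \<le> m * (m powr \<alpha> * (b - x) powr (\<alpha> + 1)) * (?w * R b)"
    using bound[of b] scale[of b] assms(8,14) by simp
  have "m * b - m * a = m * (b - a)" "0 < m * (b - a)"
    using assms(4,8) by (simp_all add: right_diff_distrib)
  then have "\<bar>S f ?y l \<alpha> (m * a) (m * b)\<bar> = \<bar>D a + D b\<bar> / (m * (b - a))"
    unfolding S_decomposition[OF assms(16) y] D_def[symmetric] abs_divide by simp
  also have "\<dots> \<le> (m * (m powr \<alpha> * (x - a) powr (\<alpha> + 1)) * (?w * R a)
      + m * (m powr \<alpha> * (b - x) powr (\<alpha> + 1)) * (?w * R b)) / (m * (b - a))"
    using \<open>0 < m * (b - a)\<close> order_trans[OF abs_triangle_ineq add_mono[OF Da Db]]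
    by (intro divide_right_mono) auto
  also have "\<dots> = (m powr \<alpha> * (x - a) powr (\<alpha> + 1) * (?w * R a)
      + m powr \<alpha> * (b - x) powr (\<alpha> + 1) * (?w * R b)) / (b - a)"
    unfolding mult.assoc distrib_left[symmetric] using assms(4) by simp
  also have "\<dots> = ?w * (m powr \<alpha> * (x - a) powr (\<alpha> + 1) / (b - a) * R a
      + m powr \<alpha> * (b - x) powr (\<alpha> + 1) / (b - a) * R b)"
    unfolding add_divide_distrib distrib_left by (simp only: mult_ac times_divide_eq_right)
  finally show ?thesis
    unfolding R_def .
qed

end
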